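(* Let $\tilde u^p(1),\tilde u^p(2),\dots$ be i.i.d. random vectors in $\mathbb{R}^{mN}$ (noise-perturbed optimal input trajectories) with $\mathbb{E}(\|\tilde u^p(i)\|^2)<+\infty$ for all $i$. For each $\mathcal{T}\ge1$ let $\hat\theta_{\mathcal{T}}$ be a solution of $$\min_{\theta\in\mathcal{D}}\ \mathcal{S}_{\mathcal{T}}(\theta)=\frac1{\mathcal{T}}\sum_{i=1}^{\mathcal{T}}\|\tilde u^p(i)-u^*_\theta\|_2^2,\qquad u^*_\theta=\arg\min_uJ(u;\theta).$$ Then $\hat\theta_{\mathcal{T}}$ is risk consistent: as $\mathcal{T}\to\infty$, $$\mathcal{S}(\hat\theta_{\mathcal{T}})\xrightarrow{P}\min\{\mathcal{S}(\theta)\mid\theta\in\mathcal{D}\},$$ where $\mathcal{S}(\theta)=\mathbb{E}(\|\tilde u^p-u^*_\theta\|_2^2)$, with $\tilde u^p$ distributed as the $\tilde u^p(i)$.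
   Context: $m,p,N,T_{\mathrm{ini}}$ are positive integers. For $\theta=\operatorname{col}(\operatorname{vech}(Q),\operatorname{vech}(R))$ with symmetric $Q\in\mathbb{R}^{p\times p}$, $R\in\mathbb{R}^{m\times m}$, put $\mathcal{Q}=\operatorname{diag}(Q,\dots,Q)$, $\mathcal{R}=\operatorname{diag}(R,\dots,R)$ ($N$ blocks each) and $$J(u;\theta)=z_{\mathrm{ini}}^TK_p^T\mathcal{Q}K_pz_{\mathrm{ini}}+2z_{\mathrm{ini}}^TK_p^T\mathcal{Q}K_fu+u^T(K_f^T\mathcal{Q}K_f+\mathcal{R})u,\qquad u\in\mathbb{R}^{mN}.$$ Here $z_{\mathrm{ini}}\in\mathbb{R}^{(m+p)T_{\mathrm{ini}}}$, $K_p\in\mathbb{R}^{pN\times(m+p)T_{\mathrm{ini}}}$ and $K_f\in\mathbb{R}^{pN\times mN}$ are fixed (deterministic), computed from data: $z_{\mathrm{ini}}$ is a stacked initial input-output trajectory and $(K_p\mid K_f)=Y_f\operatorname{col}(U_p,Y_p,U_f)^\dagger$ with $U_p,U_f,Y_p,Y_f$ the first $T_{\mathrm{ini}}$ and last $N$ block rows of the Hankel matrices of offline inputs and outputs. The constraint set is $\mathcal{D}=\{\theta=\operatorname{col}(\operatorname{vech}(Q),\operatorname{vech}(R)):\underline\varepsilon I\preceq Q,R\preceq\bar\varepsilon I\}$ with constants $0<\underline\varepsilon<\bar\varepsilon<\infty$. $\xrightarrow{P}$ denotes convergence in probability. *)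

theory Defs
  imports "HOL-Probability.Probability"
begin

text \<open>
  Dimensions are finite index types: \<open>'m\<close> (inputs), \<open>'p\<close> (outputs), \<open>'n\<close> (prediction horizon),
  \<open>'t\<close> (length of the initial trajectory) and \<open>'k\<close> (number of columns of the data Hankel matrices).
  A stacked vector with one block from \<open>real ^ 'm\<close> for each time step in \<open>'n\<close> is an element of
  \<open>real ^ ('n \<times> 'm)\<close>, and stacking on top of each other is indexed by the sum type.  Index types
  whose order matters are linearly ordered.
\<close>

definition col :: "'a ^ 'r::finite \<Rightarrow> 'a ^ 's::finite \<Rightarrow> 'a ^ ('r + 's)" where
  "col x y = (\<chi> k. case k of Inl i \<Rightarrow> x $ i | Inr j \<Rightarrow> y $ j)"

definition upper_part :: "'a ^ ('r::finite + 's::finite) \<Rightarrow> 'a ^ 'r" where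
  "upper_part z = (\<chi> i. z $ Inl i)"

definition lower_part :: "'a ^ ('r::finite + 's::finite) \<Rightarrow> 'a ^ 's" where
  "lower_part z = (\<chi> j. z $ Inr j)"

definition left_cols :: "'a ^ ('c::finite + 'd::finite) ^ 'r::finite \<Rightarrow> 'a ^ 'c ^ 'r" where
  "left_cols A = (\<chi> i. upper_part (A $ i))"

definition right_cols :: "'a ^ ('c::finite + 'd::finite) ^ 'r::finite \<Rightarrow> 'a ^ 'd ^ 'r" where
  "right_cols A = (\<chi> i. lower_part (A $ i))"


subsection \<open>Half-vectorization\<close>

text \<open>Index type of the lower triangle (diagonal included) of a square matrix.\<close>

typedef (overloaded) 'a ltri = "{k :: 'a::linorder \<times> 'a. snd k \<le> fst k}"
  by auto

instance ltri :: ("{finite, linorder}") finite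
proof
  have "inj (Rep_ltri :: 'a ltri \<Rightarrow> 'a \<times> 'a)"
    by (simp add: inj_def Rep_ltri_inject)
  then show "finite (UNIV :: 'a ltri set)"
    by (rule finite_imageD[rotated]) simp
qed

definition vech :: "real ^ 'a::{finite, linorder} ^ 'a::{finite, linorder} \<Rightarrow> real ^ 'a ltri" where
  "vech A = (\<chi> k. A $ fst (Rep_ltri k) $ snd (Rep_ltri k))"

text \<open>The symmetric matrix with a given half-vectorization.\<close>

definition unvech :: "real ^ 'a ltri \<Rightarrow> real ^ 'a::{finite, linorder} ^ 'a::{finite, linorder}" where
  "unvech v = (\<chi> i j. v $ Abs_ltri (max i j, min i j))"

lemma transpose_unvech: "transpose (unvech v) = unvech v"
  by (simp add: transpose_def unvech_def vec_eq_iff max.commute min.commute)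

lemma vech_unvech: "vech (unvech v) = v"
proof -
  have "snd (Rep_ltri k) \<le> fst (Rep_ltri k)" for k :: "'a ltri"
    using Rep_ltri[of k] by simp
  then show ?thesis
    by (simp add: vech_def unvech_def vec_eq_iff max_absorb1 min_absorb2 Rep_ltri_inverse)
qed

lemma unvech_vech:
  assumes "transpose A = A"
  shows "unvech (vech A) = A"
proof -
  have sym: "A $ i $ j = A $ j $ i" for i j
    using assms by (metis transpose_def vec_lambda_beta)
  have "Rep_ltri (Abs_ltri (max i j, min i j)) = (max i j, min i j)" for i j :: 'a
    by (rule Abs_ltri_inverse) (simp add: le_max_iff_disj min_le_iff_disj linear)
  then show ?thesis
    using sym by (auto simp: vech_def unvech_def vec_eq_iff max_def min_def)
qed


subsection \<open>Data matrices and predictor\<close>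

definition rank_of :: "'a::{finite, linorder} \<Rightarrow> nat" where
  "rank_of i = card {..<i}"

text \<open>
  \<open>CARD('l)\<close> consecutive block rows of the block Hankel matrix of the sequence \<open>w\<close> (time starts
  at 0), beginning with block row number \<open>s\<close>; it has \<open>CARD('k)\<close> columns.  If the full Hankel
  matrix has \<open>CARD('t) + CARD('n)\<close> block rows, its first \<open>CARD('t)\<close> ones are obtained with
  \<open>s = 0\<close> and its last \<open>CARD('n)\<close> ones with \<open>s = CARD('t)\<close>.
\<close>

definition hankel_rows ::
  "nat \<Rightarrow> (nat \<Rightarrow> real ^ 'q::finite) \<Rightarrow>
    real ^ 'k::{finite, linorder} ^ ('l::{finite, linorder} \<times> 'q)" where
  "hankel_rows s w = (\<chi> r c. w (s + rank_of (fst r) + rank_of c) $ snd r)"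

text \<open>Moore--Penrose inverse, characterized by the four Penrose equations.\<close>

definition pinv :: "real ^ 'c::finite ^ 'r::finite \<Rightarrow> real ^ 'r ^ 'c" where
  "pinv A = (THE X. A ** X ** A = A \<and> X ** A ** X = X \<and>
     transpose (A ** X) = A ** X \<and> transpose (X ** A) = X ** A)"

definition predictor ::
  "real ^ 'k::finite ^ 'a::finite \<Rightarrow> real ^ 'k ^ 'b::finite \<Rightarrow> real ^ 'k ^ 'c::finite \<Rightarrow>
    real ^ 'k ^ 'd::finite \<Rightarrow> real ^ (('a + 'b) + 'c) ^ 'd" where
  "predictor Up Yp Uf Yf = Yf ** pinv (col (col Up Yp) Uf)"


subsection \<open>Cost and constraint set\<close>

definition block_diag :: "real ^ 'q ^ 'q \<Rightarrow> real ^ ('n \<times> 'q) ^ ('n::finite \<times> 'q::finite)" where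
  "block_diag A = (\<chi> r c. if fst r = fst c then A $ snd r $ snd c else 0)"

definition weight_Q ::
  "real ^ ('p ltri + 'm::{finite, linorder} ltri) \<Rightarrow>
    real ^ 'p::{finite, linorder} ^ 'p::{finite, linorder}" where
  "weight_Q \<theta> = unvech (upper_part \<theta>)"

definition weight_R ::
  "real ^ ('p::{finite, linorder} ltri + 'm ltri) \<Rightarrow>
    real ^ 'm::{finite, linorder} ^ 'm::{finite, linorder}" where
  "weight_R \<theta> = unvech (lower_part \<theta>)"

definition cost ::
  "real ^ 'z::finite \<Rightarrow> real ^ 'z ^ ('n::finite \<times> 'p::{finite, linorder}) \<Rightarrow>
    real ^ ('n \<times> 'm::{finite, linorder}) ^ ('n \<times> 'p) \<Rightarrow>
    real ^ ('n \<times> 'm) \<Rightarrow> real ^ ('p ltri + 'm ltri) \<Rightarrow> real" where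
  "cost zini Kp Kf u \<theta> =
     (let QQ = block_diag (weight_Q \<theta>); RR = block_diag (weight_R \<theta>) in
       zini \<bullet> ((transpose Kp ** QQ ** Kp) *v zini)
       + 2 * (zini \<bullet> ((transpose Kp ** QQ ** Kf) *v u))
       + u \<bullet> ((transpose Kf ** QQ ** Kf + RR) *v u))"

definition u_star ::
  "real ^ 'z::finite \<Rightarrow> real ^ 'z ^ ('n::finite \<times> 'p::{finite, linorder}) \<Rightarrow>
    real ^ ('n \<times> 'm::{finite, linorder}) ^ ('n \<times> 'p) \<Rightarrow>
    real ^ ('p ltri + 'm ltri) \<Rightarrow> real ^ ('n \<times> 'm)" where
  "u_star zini Kp Kf \<theta> = arg_min (\<lambda>u. cost zini Kp Kf u \<theta>) (\<lambda>u. True)"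

definition pos_semidef :: "real ^ 'q ^ 'q::finite \<Rightarrow> bool" where
  "pos_semidef A \<longleftrightarrow> transpose A = A \<and> (\<forall>x. 0 \<le> x \<bullet> (A *v x))"

definition loewner_le :: "real ^ 'q ^ 'q::finite \<Rightarrow> real ^ 'q ^ 'q \<Rightarrow> bool" (infix \<open>\<preceq>\<close> 50) where
  "A \<preceq> B \<longleftrightarrow> pos_semidef (B - A)"

definition param_set ::
  "real \<Rightarrow> real \<Rightarrow> (real ^ ('p::{finite, linorder} ltri + 'm::{finite, linorder} ltri)) set" where
  "param_set lo hi = {col (vech Q) (vech R) | Q R.
     transpose Q = Q \<and> transpose R = R \<and>
     lo *\<^sub>R mat 1 \<preceq> Q \<and> Q \<preceq> hi *\<^sub>R mat 1 \<and>
     lo *\<^sub>R mat 1 \<preceq> R \<and> R \<preceq> hi *\<^sub>R mat 1}"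


subsection \<open>Convergence in probability\<close>

text \<open>
  The outer measure agrees with the measure on measurable sets, so this is the usual notion for
  random variables; it also makes sense for maps not known to be measurable, such as an
  arbitrary pointwise selection of minimizers.
\<close>

definition converges_in_prob :: "'w measure \<Rightarrow> (nat \<Rightarrow> 'w \<Rightarrow> real) \<Rightarrow> real \<Rightarrow> bool" where
  "converges_in_prob M X c \<longleftrightarrow>
     (\<forall>\<epsilon>>0. (\<lambda>n. outer_measure_of M {\<omega> \<in> space M. \<epsilon> < \<bar>X n \<omega> - c\<bar>}) \<longlonglongrightarrow> 0)"

end

theory Submission
  imports Defs
begin

text \<open>
  The parameter enters both risks only through the vector \<open>x \<theta> = u_star zini Kp Kf \<theta>\<close>, and both
  risks are squared distances up to an additive constant.  If \<open>m\<close> is the sample mean of the first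
  \<open>T\<close> observations and \<open>\<mu>\<close> their common expectation, the cross terms cancel and
  \<^item> the empirical risk is \<open>const + (norm (m - x \<theta>))\<^sup>2\<close>, with a constant that depends on the sample only
    (\<open>mean_square_dist\<close>);
  \<^item> the risk is \<open>const + (norm (\<mu> - x \<theta>))\<^sup>2\<close> (\<open>expectation_square_dist\<close>).

  So an empirical minimizer gives a point of \<open>x ` D\<close> nearest to \<open>m\<close>, while a minimizer of the risk gives
  a point nearest to \<open>\<mu>\<close>.  Two applications of the triangle inequality show that the former is at most
  \<open>2 * norm (m - \<mu>)\<close> farther from \<open>\<mu>\<close> than the latter (\<open>near_projection_excess\<close>).
  The excess risk is therefore controlled by the error of the sample mean alone, and the weak law for
  the random vectors themselves (\<open>weak_law_of_large_numbers\<close>), which is Chebyshev's inequality, gives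
  consistency.  Convergence is measured by an outer measure; the event that the risk is off by more
  than \<open>\<epsilon>\<close> is bounded by covering it with a measurable event on the sample mean
  (\<open>least_squares_risk_consistent\<close>).

  A minimizer of the risk exists because the parameter set is compact (\<open>compact_param_set\<close>) and the
  optimal input depends continuously on the parameter (\<open>continuous_on_u_star\<close>): it solves a linear
  system whose matrix is symmetric and bounded below by \<open>eps_lo\<close> times the identity.
\<close>


section \<open>Coercive quadratic programs\<close>

lemma matrix_inner_symmetric:
  fixes A :: "real ^ 'q::finite ^ 'q"
  assumes "transpose A = A"
  shows "(A *v x) \<bullet> y = x \<bullet> (A *v y)"
  by (metis assms dot_lmul_matrix vector_transpose_matrix)

text \<open>
  Coercivity makes \<open>H\<close> invertible; completing the square around the solution \<open>v\<close> of the stationarity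
  equation shows that \<open>v\<close> is the one and only minimizer.
\<close>

lemma arg_min_quadratic:
  fixes H :: "real ^ 'q::finite ^ 'q"
  assumes sym: "transpose H = H" and "0 < lo"
    and coercive: "\<And>x. lo * (x \<bullet> x) \<le> x \<bullet> (H *v x)"
  shows "H *v arg_min (\<lambda>u. c + 2 * (b \<bullet> u) + u \<bullet> (H *v u)) (\<lambda>u. True) = - b"
proof -
  let ?f = "\<lambda>u. c + 2 * (b \<bullet> u) + u \<bullet> (H *v u)"
  have pos: "x = 0" if "x \<bullet> (H *v x) \<le> 0" for x
  proof -
    have "lo * (x \<bullet> x) \<le> 0"
      using coercive[of x] that by linarith
    then show ?thesis
      using \<open>0 < lo\<close> by (metis inner_gt_zero_iff mult_pos_pos not_le)
  qed
  have "inj ((*v) H)"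
    unfolding linear_injective_0[OF matrix_vector_mul_linear] using pos by auto
  then have "surj ((*v) H)"
    by (intro linear_injective_imp_surjective matrix_vector_mul_linear) auto
  then obtain v where v: "H *v v = - b"
    by (metis surjD)
  \<comment> \<open>The linear terms in \<open>u - v\<close> cancel because \<open>v\<close> is stationary.\<close>
  have square: "?f u = ?f v + (u - v) \<bullet> (H *v (u - v))" for u
  proof -
    have "v \<bullet> (H *v u) = - (b \<bullet> u)"
      using matrix_inner_symmetric[OF sym, of v u] v by simp
    then show ?thesis
      by (simp add: v matrix_vector_mult_diff_distrib inner_diff_left inner_diff_right
          inner_add_right inner_commute)
  qed
  have "?f v \<le> ?f u" for u
  proof -
    have "0 \<le> lo * ((u - v) \<bullet> (u - v))"
      using \<open>0 < lo\<close> by simp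
    then show ?thesis
      using coercive[of "u - v"] square[of u] by linarith
  qed
  then have "?f (arg_min ?f (\<lambda>u. True)) = ?f v"
    by (intro arg_min_equality) auto
  then have "arg_min ?f (\<lambda>u. True) = v"
    using square[of "arg_min ?f (\<lambda>u. True)"] pos[of "arg_min ?f (\<lambda>u. True) - v"] by simp
  then show ?thesis
    using v by simp
qed

text \<open>
  The standard perturbation bound: the error \<open>v \<eta> - v \<theta>\<close> solves the system at \<open>\<eta>\<close> with the negated
  residual of \<open>v \<theta>\<close> at \<open>\<eta>\<close> as right-hand side, and coercivity bounds a solution by its right-hand
  side over \<open>lo\<close>.  The residual of the fixed vector \<open>v \<theta>\<close> is continuous in \<open>\<eta>\<close> and vanishes at \<open>\<theta>\<close>.
\<close>

lemma continuous_on_coercive_solution: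
  fixes H :: "'c::topological_space \<Rightarrow> real ^ 'q::finite ^ 'q"
  assumes H: "continuous_on D H" and b: "continuous_on D b" and "0 < lo"
    and coercive: "\<And>\<theta> x. \<theta> \<in> D \<Longrightarrow> lo * (x \<bullet> x) \<le> x \<bullet> (H \<theta> *v x)"
    and solution: "\<And>\<theta>. \<theta> \<in> D \<Longrightarrow> H \<theta> *v v \<theta> = - b \<theta>"
  shows "continuous_on D v"
  unfolding continuous_on_def
proof
  fix \<theta> assume \<theta>: "\<theta> \<in> D"
  \<comment> \<open>the residual of \<open>v \<theta>\<close> in the system at \<open>\<eta>\<close>\<close>
  let ?r = "\<lambda>\<eta>. b \<eta> + H \<eta> *v v \<theta>"
  have bound: "norm (v \<eta> - v \<theta>) \<le> norm (?r \<eta>) / lo" if "\<eta> \<in> D" for \<eta>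
  proof (cases "v \<eta> = v \<theta>")
    case False
    let ?d = "v \<eta> - v \<theta>"
    have "lo * norm ?d * norm ?d \<le> ?d \<bullet> (H \<eta> *v ?d)"
      using coercive[OF that, of ?d] by (simp add: dot_square_norm power2_eq_square)
    also have "H \<eta> *v ?d = - ?r \<eta>"
      using solution[OF that] by (simp add: matrix_vector_mult_diff_distrib)
    also have "?d \<bullet> (- ?r \<eta>) \<le> norm (?r \<eta>) * norm ?d"
      by (metis norm_cauchy_schwarz norm_minus_cancel mult.commute)
    finally show ?thesis
      using False \<open>0 < lo\<close> by (simp add: field_simps)
  qed (use \<open>0 < lo\<close> in simp)
  have "continuous_on D ?r"
    using H b unfolding matrix_vector_mult_def
    by (intro continuous_intros) 
  then have "(?r \<longlongrightarrow> ?r \<theta>) (at \<theta> within D)"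
    using \<theta> by (simp add: continuous_on_def)
  then have "((\<lambda>\<eta>. norm (?r \<eta>) / lo) \<longlongrightarrow> norm (?r \<theta>) / lo) (at \<theta> within D)"
    using \<open>0 < lo\<close> by (intro tendsto_divide tendsto_norm tendsto_const) auto
  then have r0: "((\<lambda>\<eta>. norm (?r \<eta>) / lo) \<longlongrightarrow> 0) (at \<theta> within D)"
    using solution[OF \<theta>] by simp
  have "((\<lambda>\<eta>. v \<eta> - v \<theta>) \<longlongrightarrow> 0) (at \<theta> within D)"
    by (rule Lim_null_comparison[OF _ r0]) (auto simp: eventually_at_filter bound)
  then show "(v \<longlongrightarrow> v \<theta>) (at \<theta> within D)"
    by (simp add: LIM_zero_iff)
qed

section \<open>Compactness of the parameter set\<close>

lemma upper_part_col: "upper_part (col x y) = x"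
  by (simp add: upper_part_def col_def vec_eq_iff)

lemma lower_part_col: "lower_part (col x y) = y"
  by (simp add: lower_part_def col_def vec_eq_iff)

lemma col_upper_part_lower_part: "col (upper_part z) (lower_part z) = z"
  by (auto simp: upper_part_def lower_part_def col_def vec_eq_iff split: sum.split)

lemma matrix_inner_scaled_id: "x \<bullet> ((c *\<^sub>R mat 1) *v x) = c * (x \<bullet> x)"
  for x :: "real ^ 'q::finite"
  by (simp flip: scaleR_matrix_vector_assoc)

lemma scaled_id_loewner_le_iff:
  fixes A :: "real ^ 'q::finite ^ 'q"
  assumes "transpose A = A"
  shows "c *\<^sub>R mat 1 \<preceq> A \<longleftrightarrow> (\<forall>x. c * (x \<bullet> x) \<le> x \<bullet> (A *v x))"
    and "A \<preceq> c *\<^sub>R mat 1 \<longleftrightarrow> (\<forall>x. x \<bullet> (A *v x) \<le> c * (x \<bullet> x))"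
proof -
  have "transpose (c *\<^sub>R mat 1 :: real ^ 'q ^ 'q) = c *\<^sub>R mat 1"
    by (simp add: transpose_scalar)
  then have "transpose (A - c *\<^sub>R mat 1) = A - c *\<^sub>R mat 1" "transpose (c *\<^sub>R mat 1 - A) = c *\<^sub>R mat 1 - A"
    using assms by (simp_all add: transpose_def vec_eq_iff)
  then show "c *\<^sub>R mat 1 \<preceq> A \<longleftrightarrow> (\<forall>x. c * (x \<bullet> x) \<le> x \<bullet> (A *v x))"
    and "A \<preceq> c *\<^sub>R mat 1 \<longleftrightarrow> (\<forall>x. x \<bullet> (A *v x) \<le> c * (x \<bullet> x))"
    by (simp_all add: loewner_le_def pos_semidef_def matrix_vector_mult_diff_rdistrib
        inner_diff_right matrix_inner_scaled_id)
qed

text \<open>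
  Half-vectorization is a bijection between symmetric matrices and their lower triangles, so the
  matrices witnessing membership in the parameter set can be read off from the parameter.  The
  conditions that remain are weak inequalities between continuous functions of the parameter.
\<close>

lemma mem_param_set_iff:
  "\<theta> \<in> param_set lo hi \<longleftrightarrow>
     (\<forall>x. lo * (x \<bullet> x) \<le> x \<bullet> (weight_Q \<theta> *v x)) \<and> (\<forall>x. x \<bullet> (weight_Q \<theta> *v x) \<le> hi * (x \<bullet> x)) \<and>
     (\<forall>x. lo * (x \<bullet> x) \<le> x \<bullet> (weight_R \<theta> *v x)) \<and> (\<forall>x. x \<bullet> (weight_R \<theta> *v x) \<le> hi * (x \<bullet> x))"
  (is "_ \<longleftrightarrow> ?rhs")
proof -
  have sym: "transpose (weight_Q \<theta>) = weight_Q \<theta>" "transpose (weight_R \<theta>) = weight_R \<theta>"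
    by (simp_all add: weight_Q_def weight_R_def transpose_unvech)
  have rhs: "?rhs \<longleftrightarrow> lo *\<^sub>R mat 1 \<preceq> weight_Q \<theta> \<and> weight_Q \<theta> \<preceq> hi *\<^sub>R mat 1 \<and>
      lo *\<^sub>R mat 1 \<preceq> weight_R \<theta> \<and> weight_R \<theta> \<preceq> hi *\<^sub>R mat 1"
    by (simp only: scaled_id_loewner_le_iff sym)
  have "\<theta> = col (vech (weight_Q \<theta>)) (vech (weight_R \<theta>))"
    by (simp add: weight_Q_def weight_R_def vech_unvech col_upper_part_lower_part)
  then have "\<theta> \<in> param_set lo hi" if ?rhs
    using that sym unfolding rhs param_set_def by blast
  moreover have ?rhs if "\<theta> \<in> param_set lo hi"
    using that unfolding rhs param_set_def
    by (auto simp: weight_Q_def weight_R_def upper_part_col lower_part_col unvech_vech)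
  ultimately show ?thesis
    by blast
qed

lemma continuous_on_weight_Q: "continuous_on S weight_Q"
  unfolding weight_Q_def unvech_def upper_part_def by (intro continuous_intros) 

lemma continuous_on_weight_R: "continuous_on S weight_R"
  unfolding weight_R_def unvech_def lower_part_def by (intro continuous_intros) 

lemma closed_param_set: "closed (param_set lo hi)"
proof -
  have Q: "continuous_on UNIV (\<lambda>\<theta>. x \<bullet> (weight_Q \<theta> *v x))" for x
    using continuous_on_weight_Q unfolding matrix_vector_mult_def by (intro continuous_intros) 
  have R: "continuous_on UNIV (\<lambda>\<theta>. x \<bullet> (weight_R \<theta> *v x))" for x
    using continuous_on_weight_R unfolding matrix_vector_mult_def by (intro continuous_intros) 
  have "param_set lo hi = {\<theta>. \<theta> \<in> param_set lo hi}"
    by simp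
  then have eq: "param_set lo hi = {\<theta>.
     (\<forall>x. lo * (x \<bullet> x) \<le> x \<bullet> (weight_Q \<theta> *v x)) \<and> (\<forall>x. x \<bullet> (weight_Q \<theta> *v x) \<le> hi * (x \<bullet> x)) \<and>
     (\<forall>x. lo * (x \<bullet> x) \<le> x \<bullet> (weight_R \<theta> *v x)) \<and> (\<forall>x. x \<bullet> (weight_R \<theta> *v x) \<le> hi * (x \<bullet> x))}"
    unfolding mem_param_set_iff .
  show ?thesis
    unfolding eq
    by (intro closed_Collect_conj closed_Collect_all closed_Collect_le continuous_on_const Q R)
qed

text \<open>
  Polarization: the entry \<open>(i, j)\<close> is recovered from the values of the form at the unit vectors
  \<open>i\<close> and \<open>j\<close>, of length 1, and at their sum, of length at most 2.
\<close>

lemma quadratic_form_bounds_entries: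
  fixes A :: "real ^ 'q::finite ^ 'q"
  assumes sym: "transpose A = A" and "0 \<le> hi"
    and lo: "\<And>x. 0 \<le> x \<bullet> (A *v x)" and hi: "\<And>x. x \<bullet> (A *v x) \<le> hi * (x \<bullet> x)"
  shows "\<bar>A $ i $ j\<bar> \<le> 2 * hi"
proof -
  let ?q = "\<lambda>x. x \<bullet> (A *v x)" and ?i = "axis i 1" and ?j = "axis j 1"
  have entry: "A $ i $ j = ?i \<bullet> (A *v ?j)"
    by (simp add: matrix_vector_mul_component inner_axis inner_axis' inner_commute)
  have "?j \<bullet> (A *v ?i) = ?i \<bullet> (A *v ?j)"
    using matrix_inner_symmetric[OF sym, of ?j ?i] by (simp add: inner_commute)
  then have plus: "?q (?i + ?j) = ?q ?i + 2 * A $ i $ j + ?q ?j"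
    by (simp add: entry matrix_vector_right_distrib inner_add_left inner_add_right)
  have "norm (?i + ?j :: real ^ 'q) \<le> 2"
    by (rule order_trans[OF norm_triangle_ineq]) simp
  then have "(norm (?i + ?j :: real ^ 'q))\<^sup>2 \<le> 2\<^sup>2"
    by (intro power_mono) auto
  then have "?q (?i + ?j) \<le> hi * 4"
    using mult_left_mono[OF _ \<open>0 \<le> hi\<close>] hi[of "?i + ?j"]
    by (fastforce simp: dot_square_norm)
  moreover have "?q ?i \<le> hi" "?q ?j \<le> hi"
    using hi[of ?i] hi[of ?j] by (simp_all add: dot_square_norm)
  ultimately show ?thesis
    using plus lo[of ?i] lo[of ?j] lo[of "?i + ?j"] \<open>0 \<le> hi\<close> by linarith
qed

lemma compact_param_set:
  assumes "0 \<le> lo" "lo \<le> hi"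
  shows "compact (param_set lo hi :: (real ^ ('p::{finite, linorder} ltri + 'm::{finite, linorder} ltri)) set)"
proof -
  have "\<bar>\<theta> $ k\<bar> \<le> 2 * hi" if "\<theta> \<in> param_set lo hi"
    for \<theta> :: "real ^ ('p ltri + 'm ltri)" and k
  proof -
    have nonneg: "0 \<le> lo * (x \<bullet> x)" for x :: "real ^ 'c::finite"
      using assms by simp
    have "\<bar>weight_Q \<theta> $ i $ j\<bar> \<le> 2 * hi" for i j
      using that assms unfolding mem_param_set_iff
      by (intro quadratic_form_bounds_entries)
        (auto simp: weight_Q_def transpose_unvech intro: order_trans[OF nonneg])
    moreover have "\<bar>weight_R \<theta> $ i $ j\<bar> \<le> 2 * hi" for i j
      using that assms unfolding mem_param_set_iff
      by (intro quadratic_form_bounds_entries)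
        (auto simp: weight_R_def transpose_unvech intro: order_trans[OF nonneg])
    ultimately have "\<bar>col (vech (weight_Q \<theta>)) (vech (weight_R \<theta>)) $ k\<bar> \<le> 2 * hi"
      by (simp add: col_def vech_def split: sum.split)
    then show ?thesis
      by (simp add: weight_Q_def weight_R_def vech_unvech col_upper_part_lower_part)
  qed
  then have "norm \<theta> \<le> (\<Sum>k\<in>(UNIV :: ('p ltri + 'm ltri) set). 2 * hi)" if "\<theta> \<in> param_set lo hi"
    for \<theta> :: "real ^ ('p ltri + 'm ltri)"
    using that by (intro order_trans[OF norm_le_l1_cart] sum_mono) 
  then have "bounded (param_set lo hi :: (real ^ ('p ltri + 'm ltri)) set)"
    by (rule boundedI)
  then show ?thesis
    using closed_param_set compact_eq_bounded_closed by blast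
qed

lemma param_set_nonempty:
  assumes "lo \<le> hi"
  shows "param_set lo hi \<noteq> {}"
proof -
  have le: "lo * (x \<bullet> x) \<le> hi * (x \<bullet> x)" for x :: "real ^ 'c::finite"
    using assms by (simp add: mult_right_mono)
  have "col (vech (lo *\<^sub>R mat 1)) (vech (lo *\<^sub>R mat 1)) \<in> param_set lo hi"
    by (simp add: mem_param_set_iff weight_Q_def weight_R_def upper_part_col lower_part_col
        unvech_vech transpose_scalar matrix_inner_scaled_id le)
  then show ?thesis
    by blast
qed

section \<open>Continuity of the optimal input\<close>

lemma block_diag_inner:
  fixes A :: "real ^ 'q::finite ^ 'q" and x :: "real ^ ('n::finite \<times> 'q)"
  shows "x \<bullet> (block_diag A *v x) = (\<Sum>t\<in>UNIV. (\<chi> i. x $ (t, i)) \<bullet> (A *v (\<chi> i. x $ (t, i))))"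
proof -
  have "x \<bullet> (block_diag A *v x) = (\<Sum>t\<in>UNIV. \<Sum>i\<in>UNIV. x $ (t, i) * (\<Sum>s\<in>UNIV. \<Sum>j\<in>UNIV. (if t = s then A $ i $ j else 0) * x $ (s, j)))"
    by (simp add: inner_vec_def matrix_vector_mult_def block_diag_def
        sum.cartesian_product UNIV_Times_UNIV[symmetric] case_prod_beta del: UNIV_Times_UNIV)
  also have "\<dots> = (\<Sum>t\<in>UNIV. \<Sum>i\<in>UNIV. x $ (t, i) * (\<Sum>j\<in>UNIV. A $ i $ j * x $ (t, j)))"
  proof -
    have "(\<Sum>j\<in>UNIV. (if t = s then A $ i $ j else 0) * x $ (s, j)) =
        (if t = s then (\<Sum>j\<in>UNIV. A $ i $ j * x $ (t, j)) else 0)" for t s i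
      by simp
    then show ?thesis
      by simp
  qed
  finally show ?thesis
    by (simp add: inner_vec_def matrix_vector_mult_def)
qed

lemma block_diag_coercive:
  fixes A :: "real ^ 'q::finite ^ 'q" and x :: "real ^ ('n::finite \<times> 'q)"
  assumes "\<And>y. lo * (y \<bullet> y) \<le> y \<bullet> (A *v y)"
  shows "lo * (x \<bullet> x) \<le> x \<bullet> (block_diag A *v x)"
proof -
  have "x \<bullet> x = (\<Sum>t\<in>UNIV. (\<chi> i. x $ (t, i)) \<bullet> (\<chi> i. x $ (t, i)))"
    by (simp add: inner_vec_def sum.cartesian_product UNIV_Times_UNIV[symmetric] case_prod_beta
        del: UNIV_Times_UNIV)
  then show ?thesis
    unfolding block_diag_inner by (simp add: sum_distrib_left sum_mono assms)
qed

lemma transpose_block_diag: "transpose A = A \<Longrightarrow> transpose (block_diag A) = block_diag A"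
  by (auto simp: transpose_def block_diag_def vec_eq_iff)

lemma continuous_on_block_diag:
  assumes "continuous_on S f"
  shows "continuous_on S (\<lambda>\<theta>. block_diag (f \<theta>))"
proof -
  have "continuous_on S (\<lambda>\<theta>. if P then f \<theta> $ i $ j else 0)" for P i j
    using assms by (cases P) (auto intro!: continuous_intros)
  then show ?thesis
    unfolding block_diag_def by (intro continuous_intros)
qed

lemma continuous_on_matrix_mult:
  fixes f :: "'c::topological_space \<Rightarrow> real ^ 'b::finite ^ 'a::finite"
  assumes "continuous_on S f" "continuous_on S g"
  shows "continuous_on S (\<lambda>\<theta>. f \<theta> ** g \<theta>)"
  unfolding matrix_matrix_mult_def by (intro continuous_intros assms)

text \<open>
  The matrix of the quadratic part of the cost is \<open>lo\<close>-coercive: the input weight contributes the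
  bound \<open>lo\<close>, and the output weight, conjugated by \<open>Kf\<close>, adds a positive semidefinite term.
\<close>

lemma continuous_on_u_star:
  fixes zini :: "real ^ 'z::finite"
    and Kp :: "real ^ 'z ^ ('n::finite \<times> 'p::{finite, linorder})"
    and Kf :: "real ^ ('n \<times> 'm::{finite, linorder}) ^ ('n \<times> 'p)"
  assumes "0 < lo"
  shows "continuous_on (param_set lo hi) (u_star zini Kp Kf)"
proof -
  let ?QQ = "\<lambda>\<theta>. block_diag (weight_Q \<theta>) :: real ^ ('n \<times> 'p) ^ ('n \<times> 'p)"
  let ?RR = "\<lambda>\<theta>. block_diag (weight_R \<theta>) :: real ^ ('n \<times> 'm) ^ ('n \<times> 'm)"
  let ?H = "\<lambda>\<theta> :: real ^ ('p ltri + 'm ltri). transpose Kf ** ?QQ \<theta> ** Kf + ?RR \<theta>"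
  let ?b = "\<lambda>\<theta> :: real ^ ('p ltri + 'm ltri). zini v* (transpose Kp ** ?QQ \<theta> ** Kf)"
  let ?D = "param_set lo hi :: (real ^ ('p ltri + 'm ltri)) set"
  have H: "continuous_on ?D ?H"
    by (intro continuous_intros continuous_on_matrix_mult continuous_on_block_diag
        continuous_on_weight_Q continuous_on_weight_R)
  have "continuous_on ?D (\<lambda>\<theta>. transpose Kp ** ?QQ \<theta> ** Kf)"
    by (intro continuous_intros continuous_on_matrix_mult continuous_on_block_diag
        continuous_on_weight_Q)
  then have b: "continuous_on ?D ?b"
    unfolding vector_matrix_mult_def by (intro continuous_intros)
  have coercive: "lo * (x \<bullet> x) \<le> x \<bullet> (?H \<theta> *v x)" if \<theta>: "\<theta> \<in> ?D" for \<theta> x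
  proof -
    have Q: "lo * (y \<bullet> y) \<le> y \<bullet> (weight_Q \<theta> *v y)" and R: "lo * (y' \<bullet> y') \<le> y' \<bullet> (weight_R \<theta> *v y')"
      for y y' using \<theta> by (simp_all add: mem_param_set_iff)
    have "x \<bullet> (w v* Kf) = (Kf *v x) \<bullet> w" for w
      by (metis dot_lmul_matrix inner_commute)
    then have "x \<bullet> ((transpose Kf ** ?QQ \<theta> ** Kf) *v x) = (Kf *v x) \<bullet> (?QQ \<theta> *v (Kf *v x))"
      by (simp add: matrix_vector_mul_assoc[symmetric])
    moreover have "0 \<le> lo * ((Kf *v x) \<bullet> (Kf *v x))"
      using \<open>0 < lo\<close> by simp
    ultimately show ?thesis
      using block_diag_coercive[OF Q, of "Kf *v x"] block_diag_coercive[OF R, of x]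
      by (simp add: matrix_vector_mult_add_rdistrib inner_add_right)
  qed
  have solution: "?H \<theta> *v u_star zini Kp Kf \<theta> = - ?b \<theta>" if "\<theta> \<in> ?D" for \<theta>
  proof -
    have "transpose (?QQ \<theta>) = ?QQ \<theta>" "transpose (?RR \<theta>) = ?RR \<theta>"
      by (simp_all add: transpose_block_diag weight_Q_def weight_R_def transpose_unvech)
    moreover have "transpose (A + B) = transpose A + transpose B" for A B :: "real ^ ('n \<times> 'm) ^ ('n \<times> 'm)"
      by (simp add: transpose_def vec_eq_iff)
    ultimately have "transpose (?H \<theta>) = ?H \<theta>"
      by (simp add: matrix_transpose_mul matrix_mul_assoc)
    then show ?thesis
      using arg_min_quadratic[of "?H \<theta>" lo _ "?b \<theta>"] coercive[OF that] \<open>0 < lo\<close>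
      unfolding u_star_def cost_def Let_def by (simp add: dot_lmul_matrix)
  qed
  show ?thesis
    by (rule continuous_on_coercive_solution[OF H b \<open>0 < lo\<close> coercive solution])
qed


section \<open>Squared distances to a mean\<close>

text \<open>
  The deviations from the mean sum to zero, which kills the cross terms when
  \<open>x i - v\<close> is split into \<open>x i - m\<close> and \<open>m - v\<close>.
\<close>

lemma mean_square_dist:
  fixes x :: "nat \<Rightarrow> 'a::real_inner"
  assumes "finite I" "I \<noteq> {}"
  defines "m \<equiv> (\<Sum>i\<in>I. x i) /\<^sub>R real (card I)"
  shows "(\<Sum>i\<in>I. (norm (x i - v))\<^sup>2) = (\<Sum>i\<in>I. (norm (x i - m))\<^sup>2) + real (card I) * (norm (m - v))\<^sup>2"
proof -
  have "(\<Sum>i\<in>I. x i) = real (card I) *\<^sub>R m"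
    using assms by simp
  then have "(\<Sum>i\<in>I. x i - m) = 0"
    by (simp add: sum_subtractf sum_constant_scaleR)
  then have "(\<Sum>i\<in>I. 2 * ((x i - m) \<bullet> (m - v))) = 0"
    by (metis inner_sum_left inner_zero_left mult_zero_right sum_distrib_left)
  moreover have "(norm (x i - v))\<^sup>2 = (norm (x i - m))\<^sup>2 + 2 * ((x i - m) \<bullet> (m - v)) + (norm (m - v))\<^sup>2" for i
    using dot_norm[of "x i - m" "m - v"] by simp
  ultimately show ?thesis
    by (simp add: sum.distrib)
qed

context prob_space
begin

lemma integrable_of_square_norm:
  fixes X :: "'a \<Rightarrow> 'b::{banach, second_countable_topology}"
  assumes [measurable]: "X \<in> borel_measurable M" and "integrable M (\<lambda>\<omega>. (norm (X \<omega>))\<^sup>2)"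
  shows "integrable M X"
proof -
  have "integrable M (\<lambda>\<omega>. norm (X \<omega>))"
    by (rule square_integrable_imp_integrable) (use assms in auto)
  then show ?thesis
    by (simp add: integrable_norm_iff)
qed

text \<open>
  The counterpart of \<open>mean_square_dist\<close> for expectations: a bias-variance decomposition, with the
  variance written as second moment minus squared norm of the mean.
\<close>

lemma expectation_square_dist:
  fixes X :: "'a \<Rightarrow> 'b::euclidean_space"
  assumes X [measurable]: "X \<in> borel_measurable M" and sq: "integrable M (\<lambda>\<omega>. (norm (X \<omega>))\<^sup>2)"
  defines "\<mu> \<equiv> expectation X"
  shows "expectation (\<lambda>\<omega>. (norm (X \<omega> - v))\<^sup>2) =
    expectation (\<lambda>\<omega>. (norm (X \<omega>))\<^sup>2) - (norm \<mu>)\<^sup>2 + (norm (\<mu> - v))\<^sup>2"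
    and "integrable M (\<lambda>\<omega>. (norm (X \<omega> - v))\<^sup>2)"
proof -
  have int: "integrable M X"
    by (rule integrable_of_square_norm[OF X sq])
  have expand: "(norm (y - v))\<^sup>2 = (norm y)\<^sup>2 - 2 * (y \<bullet> v) + (norm v)\<^sup>2" for y :: 'b
    by (simp add: power2_norm_eq_inner inner_diff_left inner_diff_right inner_commute)
  show "integrable M (\<lambda>\<omega>. (norm (X \<omega> - v))\<^sup>2)"
    unfolding expand using int sq by simp
  show "expectation (\<lambda>\<omega>. (norm (X \<omega> - v))\<^sup>2) =
    expectation (\<lambda>\<omega>. (norm (X \<omega>))\<^sup>2) - (norm \<mu>)\<^sup>2 + (norm (\<mu> - v))\<^sup>2"
    unfolding expand \<mu>_def using int sq by (simp add: prob_space)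
qed

section \<open>Weak law of large numbers for vectors\<close>

text \<open>
  The coordinates of independent vectors are independent real variables, so the expectation of a
  product factors in each coordinate; summing over an orthonormal basis gives the inner product.
\<close>

lemma indep_inner_expectation:
  fixes X :: "'i \<Rightarrow> 'a \<Rightarrow> 'b::euclidean_space"
  assumes indep: "indep_vars (\<lambda>_. borel) X I" and ij: "i \<in> I" "j \<in> I" "i \<noteq> j"
    and int: "integrable M (X i)" "integrable M (X j)"
  shows "integrable M (\<lambda>\<omega>. X i \<omega> \<bullet> X j \<omega>)"
    and "expectation (\<lambda>\<omega>. X i \<omega> \<bullet> X j \<omega>) = expectation (X i) \<bullet> expectation (X j)"
proof -
  have ind: "indep_vars (\<lambda>_. borel) (\<lambda>k \<omega>. X k \<omega> \<bullet> b) {i, j}" for b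
    by (rule indep_vars_compose2[OF indep_vars_subset[OF indep]]) (use ij in auto)
  have int': "integrable M (\<lambda>\<omega>. X k \<omega> \<bullet> b)" if "k \<in> {i, j}" for k b
    using that int by auto
  have int2: "integrable M (\<lambda>\<omega>. (X i \<omega> \<bullet> b) * (X j \<omega> \<bullet> b))" for b
    using indep_vars_integrable[OF _ ind[of b] int'] ij by simp
  have E2: "expectation (\<lambda>\<omega>. (X i \<omega> \<bullet> b) * (X j \<omega> \<bullet> b)) = (expectation (X i) \<bullet> b) * (expectation (X j) \<bullet> b)" for b
    using indep_vars_lebesgue_integral[OF _ ind[of b] int'] ij int by simp
  have coords: "X i \<omega> \<bullet> X j \<omega> = (\<Sum>b\<in>Basis. (X i \<omega> \<bullet> b) * (X j \<omega> \<bullet> b))" for \<omega>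
    by (rule euclidean_inner)
  show "integrable M (\<lambda>\<omega>. X i \<omega> \<bullet> X j \<omega>)"
    unfolding coords using int2 by (intro Bochner_Integration.integrable_sum)
  have "expectation (\<lambda>\<omega>. X i \<omega> \<bullet> X j \<omega>) = (\<Sum>b\<in>Basis. (expectation (X i) \<bullet> b) * (expectation (X j) \<bullet> b))"
    unfolding coords using int2 by (simp only: Bochner_Integration.integral_sum E2)
  also have "\<dots> = expectation (X i) \<bullet> expectation (X j)"
    by (rule euclidean_inner[symmetric])
  finally show "expectation (\<lambda>\<omega>. X i \<omega> \<bullet> X j \<omega>) = expectation (X i) \<bullet> expectation (X j)" .
qed

text \<open>
  Pythagoras: by \<open>indep_inner_expectation\<close>, independent centred vectors are orthogonal in the
  Hilbert space of square integrable vectors.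
\<close>

lemma expectation_square_norm_indep_sum:
  fixes X :: "'i \<Rightarrow> 'a \<Rightarrow> 'b::euclidean_space"
  assumes indep: "indep_vars (\<lambda>_. borel) X I" and fin: "finite I"
    and sq: "\<And>i. i \<in> I \<Longrightarrow> integrable M (\<lambda>\<omega>. (norm (X i \<omega>))\<^sup>2)"
    and centred: "\<And>i. i \<in> I \<Longrightarrow> expectation (X i) = 0"
  shows "integrable M (\<lambda>\<omega>. (norm (\<Sum>i\<in>I. X i \<omega>))\<^sup>2)"
    and "expectation (\<lambda>\<omega>. (norm (\<Sum>i\<in>I. X i \<omega>))\<^sup>2) = (\<Sum>i\<in>I. expectation (\<lambda>\<omega>. (norm (X i \<omega>))\<^sup>2))"
proof -
  have meas: "X i \<in> borel_measurable M" if "i \<in> I" for i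
    using indep that by (auto simp: indep_vars_def)
  have cross: "integrable M (\<lambda>\<omega>. X i \<omega> \<bullet> X j \<omega>)"
      "expectation (\<lambda>\<omega>. X i \<omega> \<bullet> X j \<omega>) = (if i = j then expectation (\<lambda>\<omega>. (norm (X i \<omega>))\<^sup>2) else 0)"
    if "i \<in> I" "j \<in> I" for i j
    using that sq[of i] indep_inner_expectation[OF indep, of i j] centred
      integrable_of_square_norm[OF meas sq]
    by (cases "i = j"; simp add: power2_norm_eq_inner)+
  have expand: "(norm (\<Sum>i\<in>I. X i \<omega>))\<^sup>2 = (\<Sum>i\<in>I. \<Sum>j\<in>I. X i \<omega> \<bullet> X j \<omega>)" for \<omega>
    by (simp add: power2_norm_eq_inner inner_sum_left inner_sum_right) (rule sum.swap)
  show "integrable M (\<lambda>\<omega>. (norm (\<Sum>i\<in>I. X i \<omega>))\<^sup>2)"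
    unfolding expand using cross(1) by auto
  have "expectation (\<lambda>\<omega>. (norm (\<Sum>i\<in>I. X i \<omega>))\<^sup>2) = (\<Sum>i\<in>I. \<Sum>j\<in>I. expectation (\<lambda>\<omega>. X i \<omega> \<bullet> X j \<omega>))"
    unfolding expand using cross(1) by (simp add: Bochner_Integration.integral_sum)
  also have "\<dots> = (\<Sum>i\<in>I. expectation (\<lambda>\<omega>. (norm (X i \<omega>))\<^sup>2))"
    using fin by (simp add: cross(2))
  finally show "expectation (\<lambda>\<omega>. (norm (\<Sum>i\<in>I. X i \<omega>))\<^sup>2) = (\<Sum>i\<in>I. expectation (\<lambda>\<omega>. (norm (X i \<omega>))\<^sup>2))" .
qed

text \<open>
  The squared norm of the sum of the first \<open>n\<close> deviations from \<open>\<mu>\<close> has expectation \<open>n * V\<close>, whereas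
  a deviation of the sample mean by \<open>\<delta>\<close> makes it at least \<open>(n * \<delta>)\<^sup>2\<close>; Markov's inequality bounds
  the probability by \<open>V / (\<delta>\<^sup>2 * n)\<close>.
\<close>

lemma weak_law_of_large_numbers:
  fixes X :: "nat \<Rightarrow> 'a \<Rightarrow> 'b::euclidean_space"
  assumes indep: "indep_vars (\<lambda>_. borel) X {1..}"
    and sq: "\<And>i. i \<ge> 1 \<Longrightarrow> integrable M (\<lambda>\<omega>. (norm (X i \<omega>))\<^sup>2)"
    and mean: "\<And>i. i \<ge> 1 \<Longrightarrow> expectation (X i) = \<mu>"
    and var: "\<And>i. i \<ge> 1 \<Longrightarrow> expectation (\<lambda>\<omega>. (norm (X i \<omega> - \<mu>))\<^sup>2) = V"
    and "0 < \<delta>"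
  shows "(\<lambda>n. emeasure M {\<omega> \<in> space M. \<delta> \<le> norm ((\<Sum>i=1..n. X i \<omega>) /\<^sub>R real n - \<mu>)}) \<longlonglongrightarrow> 0"
proof -
  have meas [measurable]: "X i \<in> borel_measurable M" if "i \<ge> 1" for i
    using indep that by (auto simp: indep_vars_def)
  have bound: "prob {\<omega> \<in> space M. \<delta> \<le> norm ((\<Sum>i=1..n. X i \<omega>) /\<^sub>R real n - \<mu>)} \<le> V / \<delta>\<^sup>2 / real n"
    if "n \<ge> 1" for n
  proof -
    let ?Y = "\<lambda>i \<omega>. X i \<omega> - \<mu>" and ?S = "\<lambda>\<omega>. (norm (\<Sum>i=1..n. X i \<omega> - \<mu>))\<^sup>2"
    have ind: "indep_vars (\<lambda>_. borel) ?Y {1..n}"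
      by (rule indep_vars_compose2[OF indep_vars_subset[OF indep]]) auto
    have "integrable M (\<lambda>\<omega>. (norm (?Y i \<omega>))\<^sup>2)" "expectation (?Y i) = 0" if "i \<in> {1..n}" for i
      using that expectation_square_dist(2)[of "X i" \<mu>] meas sq mean
        integrable_of_square_norm[of "X i"] by (auto simp: prob_space)
    note sum = expectation_square_norm_indep_sum[OF ind _ this]
    have int: "integrable M ?S" and E: "expectation ?S = real n * V"
      using sum var by simp_all
    have scale: "(\<Sum>i=1..n. X i \<omega> - \<mu>) = real n *\<^sub>R ((\<Sum>i=1..n. X i \<omega>) /\<^sub>R real n - \<mu>)" for \<omega>
      using that by (simp add: sum_subtractf sum_constant_scaleR scaleR_right_diff_distrib)
    have "{\<omega> \<in> space M. \<delta> \<le> norm ((\<Sum>i=1..n. X i \<omega>) /\<^sub>R real n - \<mu>)} \<subseteq> {\<omega> \<in> space M. (real n * \<delta>)\<^sup>2 \<le> ?S \<omega>}"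
      unfolding scale using \<open>0 < \<delta>\<close> by (auto intro!: power_mono mult_left_mono)
    then have "prob {\<omega> \<in> space M. \<delta> \<le> norm ((\<Sum>i=1..n. X i \<omega>) /\<^sub>R real n - \<mu>)}
        \<le> prob {\<omega> \<in> space M. (real n * \<delta>)\<^sup>2 \<le> ?S \<omega>}"
      using int by (intro finite_measure_mono) (auto dest: borel_measurable_integrable)
    also have "\<dots> \<le> expectation ?S / (real n * \<delta>)\<^sup>2"
      using that \<open>0 < \<delta>\<close> by (intro integral_Markov_inequality_measure[OF int, of "{}"]) auto
    also have "\<dots> = V / \<delta>\<^sup>2 / real n"
      unfolding E using that by (simp add: power2_eq_square)
    finally show ?thesis .
  qed
  have "(\<lambda>n. prob {\<omega> \<in> space M. \<delta> \<le> norm ((\<Sum>i=1..n. X i \<omega>) /\<^sub>R real n - \<mu>)}) \<longlonglongrightarrow> 0"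
  proof (rule tendsto_sandwich[OF _ _ tendsto_const])
    show "(\<lambda>n. V / \<delta>\<^sup>2 / real n) \<longlonglongrightarrow> 0"
      by (rule lim_const_over_n)
    show "\<forall>\<^sub>F n in sequentially. prob {\<omega> \<in> space M. \<delta> \<le> norm ((\<Sum>i=1..n. X i \<omega>) /\<^sub>R real n - \<mu>)} \<le> V / \<delta>\<^sup>2 / real n"
      using eventually_ge_at_top[of 1] by eventually_elim (rule bound)
  qed simp
  then show ?thesis
    unfolding emeasure_eq_measure by (simp add: tendsto_ennreal_iff flip: ennreal_0)
qed

end

section \<open>Consistency of least squares\<close>

text \<open>
  Here \<open>y\<close> is as good a fit to the perturbed centre \<open>c\<close> as \<open>x\<close> is, and \<open>x\<close> as good a fit to the true
  centre \<open>\<mu>\<close> as \<open>y\<close> is.  Passing from \<open>\<mu>\<close> to \<open>c\<close> and back costs \<open>\<delta>\<close> each time, so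
  \<open>norm (\<mu> - y)\<close> is at most \<open>2 * \<delta> + norm (\<mu> - x)\<close>.
\<close>

lemma near_projection_excess:
  fixes \<mu> :: "'a::real_normed_vector"
  assumes opt: "norm (c - y) \<le> norm (c - x)" and lower: "norm (\<mu> - x) \<le> norm (\<mu> - y)"
    and close: "norm (c - \<mu>) \<le> \<delta>"
  shows "\<bar>(norm (\<mu> - y))\<^sup>2 - (norm (\<mu> - x))\<^sup>2\<bar> \<le> 4 * \<delta> * (\<delta> + norm (\<mu> - x))"
proof -
  have "norm (\<mu> - y) \<le> norm (c - \<mu>) + norm (c - y)"
    using norm_triangle_ineq4[of "c - y" "c - \<mu>"] by simp
  moreover have "norm (c - x) \<le> norm (c - \<mu>) + norm (\<mu> - x)"
    using norm_triangle_ineq[of "c - \<mu>" "\<mu> - x"] by simp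
  ultimately have "norm (\<mu> - y) \<le> 2 * \<delta> + norm (\<mu> - x)"
    using opt close by linarith
  then have "(norm (\<mu> - y))\<^sup>2 \<le> (2 * \<delta> + norm (\<mu> - x))\<^sup>2"
    by (intro power_mono) auto
  moreover have "(norm (\<mu> - x))\<^sup>2 \<le> (norm (\<mu> - y))\<^sup>2"
    using lower by (intro power_mono) auto
  ultimately show ?thesis
    by (simp add: power2_eq_square algebra_simps)
qed


context prob_space
begin

text \<open>
  When the sample mean is within \<open>\<delta>\<close> of \<open>\<mu>\<close>, \<open>near_projection_excess\<close> bounds the excess of the fitted
  parameter by a quantity that vanishes with \<open>\<delta>\<close>; so a large excess forces a large error of the sample
  mean, which the weak law makes unlikely.  The constant \<open>c\<close> turns squared distances into values of
  the risk.
\<close>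

lemma least_squares_risk_consistent:
  fixes X :: "nat \<Rightarrow> 'a \<Rightarrow> 'b::euclidean_space" and x :: "'c \<Rightarrow> 'b"
  assumes indep: "indep_vars (\<lambda>_. borel) X {1..}"
    and sq: "\<And>i. i \<ge> 1 \<Longrightarrow> integrable M (\<lambda>\<omega>. (norm (X i \<omega>))\<^sup>2)"
    and mean: "\<And>i. i \<ge> 1 \<Longrightarrow> expectation (X i) = \<mu>"
    and var: "\<And>i. i \<ge> 1 \<Longrightarrow> expectation (\<lambda>\<omega>. (norm (X i \<omega> - \<mu>))\<^sup>2) = V"
    and \<theta>0: "\<theta>0 \<in> D" "\<And>\<theta>. \<theta> \<in> D \<Longrightarrow> norm (\<mu> - x \<theta>0) \<le> norm (\<mu> - x \<theta>)"
    and \<theta>hat: "\<And>n \<omega>. n \<ge> 1 \<Longrightarrow> \<omega> \<in> space M \<Longrightarrow>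
      is_arg_min (\<lambda>\<theta>. \<Sum>i=1..n. (norm (X i \<omega> - x \<theta>))\<^sup>2) (\<lambda>\<theta>. \<theta> \<in> D) (\<theta>hat n \<omega>)"
  shows "converges_in_prob M (\<lambda>n \<omega>. c + (norm (\<mu> - x (\<theta>hat n \<omega>)))\<^sup>2) (c + (norm (\<mu> - x \<theta>0))\<^sup>2)"
  unfolding converges_in_prob_def
proof (intro allI impI)
  fix \<epsilon> :: real assume "0 < \<epsilon>"
  let ?m = "\<lambda>n \<omega>. (\<Sum>i=1..n. X i \<omega>) /\<^sub>R real n" and ?d = "norm (\<mu> - x \<theta>0)"
  \<comment> \<open>Chosen such that the excess \<open>4 * \<delta> * (\<delta> + ?d)\<close> of an approximate projection is at most \<open>\<epsilon>\<close>;
    the cap 1 makes the requirement linear in \<open>\<delta>\<close>.\<close>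
  define \<delta> where "\<delta> = min 1 (\<epsilon> / (4 * (1 + ?d)))"
  have d: "0 < 1 + ?d"
    using norm_ge_zero[of "\<mu> - x \<theta>0"] by linarith
  have \<delta>: "0 < \<delta>" "\<delta> \<le> 1"
    using \<open>0 < \<epsilon>\<close> d by (auto simp: \<delta>_def)
  have "\<delta> * (4 * (1 + ?d)) \<le> \<epsilon>"
    using d pos_le_divide_eq[of "4 * (1 + ?d)" \<delta> \<epsilon>] by (simp add: \<delta>_def)
  moreover have "\<delta> * (\<delta> + ?d) \<le> \<delta> * (1 + ?d)"
    using \<delta> by (intro mult_left_mono) auto
  ultimately have \<delta>_\<epsilon>: "4 * \<delta> * (\<delta> + ?d) \<le> \<epsilon>"
    by (simp add: algebra_simps)
  let ?A = "\<lambda>n. {\<omega> \<in> space M. \<epsilon> < \<bar>c + (norm (\<mu> - x (\<theta>hat n \<omega>)))\<^sup>2 - (c + ?d\<^sup>2)\<bar>}"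
  let ?B = "\<lambda>n. {\<omega> \<in> space M. \<delta> \<le> norm (?m n \<omega> - \<mu>)}"
  have sub: "?A n \<subseteq> ?B n" if "n \<ge> 1" for n
  proof
    fix \<omega> assume \<omega>: "\<omega> \<in> ?A n"
    let ?y = "x (\<theta>hat n \<omega>)"
    have "is_arg_min (\<lambda>\<theta>. \<Sum>i=1..n. (norm (X i \<omega> - x \<theta>))\<^sup>2) (\<lambda>\<theta>. \<theta> \<in> D) (\<theta>hat n \<omega>)"
      using \<omega> that by (intro \<theta>hat) auto
    then have mem: "\<theta>hat n \<omega> \<in> D"
      and "(\<Sum>i=1..n. (norm (X i \<omega> - ?y))\<^sup>2) \<le> (\<Sum>i=1..n. (norm (X i \<omega> - x \<theta>0))\<^sup>2)"
      using \<theta>0(1) by (auto simp: is_arg_min_linorder)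
    moreover have "(\<Sum>i=1..n. (norm (X i \<omega> - v))\<^sup>2) =
        (\<Sum>i=1..n. (norm (X i \<omega> - ?m n \<omega>))\<^sup>2) + real n * (norm (?m n \<omega> - v))\<^sup>2" for v
      using that mean_square_dist[of "{1..n}" "\<lambda>i. X i \<omega>" v] by simp
    note this[of ?y] this[of "x \<theta>0"]
    ultimately have "real n * (norm (?m n \<omega> - ?y))\<^sup>2 \<le> real n * (norm (?m n \<omega> - x \<theta>0))\<^sup>2"
      by linarith
    then have opt: "norm (?m n \<omega> - ?y) \<le> norm (?m n \<omega> - x \<theta>0)"
      using that by (simp add: power_mono_iff)
    have "\<not> norm (?m n \<omega> - \<mu>) \<le> \<delta>"
      using near_projection_excess[OF opt \<theta>0(2)[OF mem]] \<delta>_\<epsilon> \<omega> by fastforce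
    then show "\<omega> \<in> ?B n"
      using \<omega> by auto
  qed
  have meas [measurable]: "X i \<in> borel_measurable M" if "i \<ge> 1" for i
    using indep that by (auto simp: indep_vars_def)
  have "(\<lambda>\<omega>. \<Sum>i=1..n. X i \<omega>) \<in> borel_measurable M" for n
    by (intro borel_measurable_sum) auto
  then have [measurable]: "?B n \<in> sets M" for n
    by measurable
  have outer_le: "outer_measure_of M (?A n) \<le> emeasure M (?B n)" if "n \<ge> 1" for n
    using outer_measure_of_mono[OF sub[OF that], of M] by simp
  show "(\<lambda>n. outer_measure_of M (?A n)) \<longlonglongrightarrow> 0"
  proof (rule tendsto_sandwich[OF _ _ tendsto_const])
    show "(\<lambda>n. emeasure M (?B n)) \<longlonglongrightarrow> 0"
      by (rule weak_law_of_large_numbers[OF indep sq mean var \<delta>(1)])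
    show "\<forall>\<^sub>F n in sequentially. outer_measure_of M (?A n) \<le> emeasure M (?B n)"
      using eventually_ge_at_top[of 1] by eventually_elim (rule outer_le)
  qed simp
qed

end

theorem corollary3:
  fixes M :: "'w measure"
    and ud :: "nat \<Rightarrow> real ^ 'm::{finite, linorder}"
    and yd :: "nat \<Rightarrow> real ^ 'p::{finite, linorder}"
    and uini :: "real ^ ('t::{finite, linorder} \<times> 'm)"
    and yini :: "real ^ ('t \<times> 'p)"
    and zini :: "real ^ (('t \<times> 'm) + ('t \<times> 'p))"
    and Up :: "real ^ 'k::{finite, linorder} ^ ('t \<times> 'm)"
    and Yp :: "real ^ 'k::{finite, linorder} ^ ('t \<times> 'p)"
    and Uf :: "real ^ 'k::{finite, linorder} ^ ('n::{finite, linorder} \<times> 'm)"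
    and Yf :: "real ^ 'k::{finite, linorder} ^ ('n \<times> 'p)"
    and Kp :: "real ^ (('t \<times> 'm) + ('t \<times> 'p)) ^ ('n \<times> 'p)"
    and Kf :: "real ^ ('n \<times> 'm) ^ ('n \<times> 'p)"
    and eps_lo eps_hi :: real
    and D :: "(real ^ ('p ltri + 'm ltri)) set"
    and u :: "nat \<Rightarrow> 'w \<Rightarrow> real ^ ('n \<times> 'm)"
    and u0 :: "'w \<Rightarrow> real ^ ('n \<times> 'm)"
    and emp_risk :: "nat \<Rightarrow> 'w \<Rightarrow> real ^ ('p ltri + 'm ltri) \<Rightarrow> real"
    and risk :: "real ^ ('p ltri + 'm ltri) \<Rightarrow> real"
    and \<theta>hat :: "nat \<Rightarrow> 'w \<Rightarrow> real ^ ('p ltri + 'm ltri)"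
  assumes zini: "zini = col uini yini"
    and Up: "Up = hankel_rows 0 ud"
    and Yp: "Yp = hankel_rows 0 yd"
    and Uf: "Uf = hankel_rows CARD('t) ud"
    and Yf: "Yf = hankel_rows CARD('t) yd"
    and Kp: "Kp = left_cols (predictor Up Yp Uf Yf)"
    and Kf: "Kf = right_cols (predictor Up Yp Uf Yf)"
    and eps: "0 < eps_lo" "eps_lo < eps_hi"
    and D: "D = param_set eps_lo eps_hi"
    and prob: "prob_space M"
    and indep: "prob_space.indep_vars M (\<lambda>_. borel) u {1..}"
    and u0: "u0 \<in> borel_measurable M"
    and ident: "\<And>i. i \<ge> 1 \<Longrightarrow> distr M borel (u i) = distr M borel u0"
    and second_moment: "\<And>i. i \<ge> 1 \<Longrightarrow> integrable M (\<lambda>\<omega>. (norm (u i \<omega>))\<^sup>2)"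
    and emp_risk: "\<And>T \<omega> \<theta>. emp_risk T \<omega> \<theta> =
          1 / real T * (\<Sum>i=1..T. (norm (u i \<omega> - u_star zini Kp Kf \<theta>))\<^sup>2)"
    and risk: "\<And>\<theta>. risk \<theta> = (\<integral>\<omega>. (norm (u0 \<omega> - u_star zini Kp Kf \<theta>))\<^sup>2 \<partial>M)"
    and \<theta>hat: "\<And>T \<omega>. T \<ge> 1 \<Longrightarrow> \<omega> \<in> space M \<Longrightarrow>
          is_arg_min (emp_risk T \<omega>) (\<lambda>\<theta>. \<theta> \<in> D) (\<theta>hat T \<omega>)"
  shows "\<exists>\<theta>0. is_arg_min risk (\<lambda>\<theta>. \<theta> \<in> D) \<theta>0 \<and>
           converges_in_prob M (\<lambda>T \<omega>. risk (\<theta>hat T \<omega>)) (risk \<theta>0)"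
proof -
  interpret prob_space M
    by (rule prob)
  let ?x = "u_star zini Kp Kf"
  define \<mu> where "\<mu> = expectation u0"
  have meas: "u i \<in> borel_measurable M" if "i \<ge> 1" for i
    using indep that by (auto simp: indep_vars_def)
  \<comment> \<open>Integrals of functions of \<open>u i\<close> depend on its distribution only, which is that of \<open>u0\<close>.\<close>
  have transfer: "integrable M (\<lambda>\<omega>. g (u i \<omega>)) \<longleftrightarrow> integrable M (\<lambda>\<omega>. g (u0 \<omega>))"
      "expectation (\<lambda>\<omega>. g (u i \<omega>)) = expectation (\<lambda>\<omega>. g (u0 \<omega>))"
    if "i \<ge> 1" "g \<in> borel_measurable borel"
    for i and g :: "real ^ ('n \<times> 'm) \<Rightarrow> 'v::{banach, second_countable_topology}"
    using integrable_distr_eq[OF meas[OF that(1)] that(2)] integrable_distr_eq[OF u0 that(2)]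
      integral_distr[OF meas[OF that(1)] that(2)] integral_distr[OF u0 that(2)] ident[OF that(1)]
    by simp_all
  have u0_sq: "integrable M (\<lambda>\<omega>. (norm (u0 \<omega>))\<^sup>2)"
    using second_moment[of 1] transfer(1)[of 1 "\<lambda>y. (norm y)\<^sup>2"] by simp
  have mean: "expectation (u i) = \<mu>" if "i \<ge> 1" for i
    using transfer(2)[OF that, of "\<lambda>y. y"] by (simp add: \<mu>_def)
  have var: "expectation (\<lambda>\<omega>. (norm (u i \<omega> - \<mu>))\<^sup>2) = expectation (\<lambda>\<omega>. (norm (u0 \<omega> - \<mu>))\<^sup>2)"
    if "i \<ge> 1" for i
    by (rule transfer(2)[OF that]) simp
  define c where "c = expectation (\<lambda>\<omega>. (norm (u0 \<omega>))\<^sup>2) - (norm \<mu>)\<^sup>2"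
  have risk_eq: "risk \<theta> = c + (norm (\<mu> - ?x \<theta>))\<^sup>2" for \<theta>
    unfolding risk c_def \<mu>_def by (rule expectation_square_dist(1)[OF u0 u0_sq])
  have "continuous_on D (\<lambda>\<theta>. norm (\<mu> - ?x \<theta>))"
    unfolding D by (intro continuous_intros continuous_on_u_star eps)
  moreover have "compact D" "D \<noteq> {}"
    using eps by (auto simp: D compact_param_set param_set_nonempty)
  ultimately obtain \<theta>0 where \<theta>0: "\<theta>0 \<in> D" "\<And>\<theta>. \<theta> \<in> D \<Longrightarrow> norm (\<mu> - ?x \<theta>0) \<le> norm (\<mu> - ?x \<theta>)"
    using continuous_attains_inf[of D "\<lambda>\<theta>. norm (\<mu> - ?x \<theta>)"] by blast
  have fit: "is_arg_min (\<lambda>\<theta>. \<Sum>i=1..T. (norm (u i \<omega> - ?x \<theta>))\<^sup>2) (\<lambda>\<theta>. \<theta> \<in> D) (\<theta>hat T \<omega>)"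
    if "T \<ge> 1" "\<omega> \<in> space M" for T \<omega>
    using \<theta>hat[OF that] that(1) by (simp add: is_arg_min_linorder emp_risk divide_le_cancel)
  have "is_arg_min risk (\<lambda>\<theta>. \<theta> \<in> D) \<theta>0"
    using \<theta>0 by (auto simp: is_arg_min_linorder risk_eq intro: power_mono)
  moreover have "converges_in_prob M (\<lambda>T \<omega>. risk (\<theta>hat T \<omega>)) (risk \<theta>0)"
    unfolding risk_eq
    by (rule least_squares_risk_consistent[where X = u and x = ?x, OF indep second_moment mean var \<theta>0 fit])
  ultimately show ?thesis
    by blast
qed

end
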